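(* The sum index of the triangular grids $T_n$ grows with $n$; more precisely, $s(T_n)=\Omega(n^{2/3})$ as $n\to\infty$, i.e., there exist a constant $c>0$ and an integer $n_0$ such that $s(T_n)\geq c\,n^{2/3}$ for all integers $n\geq n_0$.
   Context: A vertex labeling of a graph $G$ is an injective map $f:V(G)\to\mathbb{Z}$. It induces the edge labeling $f^+:E(G)\to\mathbb{Z}$, $f^+(uv)=f(u)+f(v)$, and $|f^+|$ denotes the number of distinct values $f^+$ takes on $E(G)$. The sum index $s(G)$ is the minimum positive integer $k$ such that there exists a vertex labeling $f$ of $G$ with $|f^+|=k$. For a positive integer $n$, the triangular grid $T_n$ is the graph with vertex set $\{v_{i,j}:0\leq i\leq n,\ 0\leq j\leq i\}$ and edge set $\{v_{i,j}v_{i',j'}:|i-i'|+|j-j'|=1\text{ or }(i-i')(j-j')=1\}$. *)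

theory Defs
  imports Complex_Main "Graph_Theory.Pair_Digraph"
begin

text \<open>
  As usual in the Graph Theory library, a simple graph is a symmetric loop-free digraph
  (\<^locale>\<open>pair_graph\<close>), so an undirected edge is represented by two opposite arcs. The induced
  edge label is symmetric in its endpoints, so both arcs carry the label of the edge.
\<close>

definition vertex_labeling :: "'a pair_pre_digraph \<Rightarrow> ('a \<Rightarrow> int) \<Rightarrow> bool" where
  "vertex_labeling G f \<longleftrightarrow> inj_on f (pverts G)"

definition edge_label :: "('a \<Rightarrow> int) \<Rightarrow> 'a \<times> 'a \<Rightarrow> int" where
  "edge_label f e = f (fst e) + f (snd e)"

definition num_edge_labels :: "'a pair_pre_digraph \<Rightarrow> ('a \<Rightarrow> int) \<Rightarrow> nat" where
  "num_edge_labels G f = card (edge_label f ` parcs G)"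

text \<open>
  Meaningful for finite graphs with at least one edge; see \<open>sum_index_attained\<close> below.
\<close>

definition sum_index :: "'a pair_pre_digraph \<Rightarrow> nat" where
  "sum_index G = (LEAST k. 0 < k \<and> (\<exists>f. vertex_labeling G f \<and> num_edge_labels G f = k))"

definition triangular_grid_verts :: "nat \<Rightarrow> (int \<times> int) set" where
  "triangular_grid_verts n = {(i, j). 0 \<le> i \<and> i \<le> int n \<and> 0 \<le> j \<and> j \<le> i}"

definition triangular_grid :: "nat \<Rightarrow> (int \<times> int) pair_pre_digraph" where
  "triangular_grid n = \<lparr>
     pverts = triangular_grid_verts n,
     parcs = {((i, j), (i', j')) | i j i' j'.
       (i, j) \<in> triangular_grid_verts n \<and> (i', j') \<in> triangular_grid_verts n \<and>
       (\<bar>i - i'\<bar> + \<bar>j - j'\<bar> = 1 \<or> (i - i') * (j - j') = 1)} \<rparr>"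

lemma edge_label_swap: "edge_label f (v, u) = edge_label f (u, v)"
  by (simp add: edge_label_def)

lemma sum_index_attained:
  fixes G :: "'a pair_pre_digraph"
  assumes "finite (pverts G)" "finite (parcs G)" "parcs G \<noteq> {}"
  shows "0 < sum_index G" "\<exists>f. vertex_labeling G f \<and> num_edge_labels G f = sum_index G"
proof -
  obtain g :: "'a \<Rightarrow> nat" where "inj_on g (pverts G)"
    using finite_imp_inj_to_nat_seg[OF assms(1)] by blast
  then have "vertex_labeling G (\<lambda>v. int (g v))"
    by (auto simp: vertex_labeling_def inj_on_def)
  moreover have "0 < num_edge_labels G (\<lambda>v. int (g v))"
    using assms(2,3) by (simp add: num_edge_labels_def card_gt_0_iff)
  ultimately have "\<exists>k. 0 < k \<and> (\<exists>f. vertex_labeling G f \<and> num_edge_labels G f = k)"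
    by blast
  from LeastI_ex[OF this]
  show "0 < sum_index G" "\<exists>f. vertex_labeling G f \<and> num_edge_labels G f = sum_index G"
    by (auto simp: sum_index_def)
qed

lemma finite_triangular_grid_verts: "finite (triangular_grid_verts n)"
  by (rule finite_subset[of _ "{0..int n} \<times> {0..int n}"]) (auto simp: triangular_grid_verts_def)

lemma pair_graph_triangular_grid: "pair_graph (triangular_grid n)"
proof
  show "finite (pverts (triangular_grid n))"
    by (simp add: triangular_grid_def finite_triangular_grid_verts)
  show "finite (parcs (triangular_grid n))"
    by (rule finite_subset[of _ "triangular_grid_verts n \<times> triangular_grid_verts n"])
      (auto simp: triangular_grid_def finite_triangular_grid_verts)
  show "symmetric (with_proj (triangular_grid n))"
    unfolding symmetric_def sym_def
    by (auto simp: triangular_grid_def arcs_ends_def arc_to_ends_def algebra_simps abs_minus_commute)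
qed (auto simp: triangular_grid_def)

lemma triangular_grid_has_edge:
  assumes "0 < n"
  shows "parcs (triangular_grid n) \<noteq> {}"
proof -
  have "((0, 0), (1, 0)) \<in> parcs (triangular_grid n)"
    using assms by (simp add: triangular_grid_def triangular_grid_verts_def)
  then show ?thesis by blast
qed

end

theory Submission
  imports Defs
begin

text \<open>
  The three edge labels of a triangle determine the labels of its corners, since
  \<open>2 f(u) = (f(u) + f(v)) + (f(u) + f(w)) - (f(v) + f(w))\<close>. If \<open>k\<close> edge labels occur, vertices
  that lie in triangles therefore receive at most \<open>k\<^sup>3\<close> different labels, so by injectivity there
  are at most \<open>k\<^sup>3\<close> such vertices (\<open>card_triangle_vertices_le_cube\<close>). In the triangular grid every
  vertex outside the last row is the apex of a triangle reaching into the next row, and there are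
  about \<open>n\<^sup>2 / 2\<close> of these; hence \<open>k\<^sup>3 \<ge> n\<^sup>2 / 2\<close>, which is the asserted growth \<open>n\<^bsup>2/3\<^esup>\<close>.
\<close>

text \<open>
  The corner that is recovered has to be known in advance, so vertices are mapped to ordered
  triples of edge labels: the labels of the two edges at the vertex, then that of the opposite edge.
\<close>

lemma card_triangle_vertices_le_cube:
  assumes "vertex_labeling G f" "finite (parcs G)" "W \<subseteq> pverts G"
    and triangle: "\<And>u. u \<in> W \<Longrightarrow> \<exists>v w. (u, v) \<in> parcs G \<and> (u, w) \<in> parcs G \<and> (v, w) \<in> parcs G"
  shows "card W \<le> num_edge_labels G f ^ 3"
proof -
  define S where "S = edge_label f ` parcs G"
  have fin: "finite S"
    using assms(2) by (simp add: S_def)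
  have "f ` W \<subseteq> (\<lambda>(a, b, c). (a + b - c) div 2) ` (S \<times> S \<times> S)"
  proof
    fix y assume "y \<in> f ` W"
    then obtain u where u: "u \<in> W" "y = f u" by blast
    obtain v w where e: "(u, v) \<in> parcs G" "(u, w) \<in> parcs G" "(v, w) \<in> parcs G"
      using triangle[OF u(1)] by blast
    have "(edge_label f (u, v), edge_label f (u, w), edge_label f (v, w)) \<in> S \<times> S \<times> S"
      using e by (simp add: S_def)
    moreover have "y = (edge_label f (u, v) + edge_label f (u, w) - edge_label f (v, w)) div 2"
      by (simp add: u(2) edge_label_def)
    ultimately show "y \<in> (\<lambda>(a, b, c). (a + b - c) div 2) ` (S \<times> S \<times> S)"
      by force
  qed
  then have "card (f ` W) \<le> card (S \<times> S \<times> S)"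
    using fin by (intro surj_card_le) auto
  moreover have "inj_on f W"
    using assms(1,3) by (auto simp: vertex_labeling_def intro: inj_on_subset)
  ultimately show ?thesis
    by (simp add: card_image card_cartesian_product num_edge_labels_def S_def power3_eq_cube)
qed

text \<open>
  The triangle of index pairs and its mirror image in the diagonal together cover the square of
  \<open>(n + 1)\<^sup>2\<close> pairs; the overlap on the diagonal does not affect the order of magnitude.
\<close>

lemma card_triangular_grid_verts_ge: "(n + 1)\<^sup>2 \<le> 2 * card (triangular_grid_verts n)"
proof -
  let ?V = "triangular_grid_verts n"
  have "{0..int n} \<times> {0..int n} \<subseteq> ?V \<union> prod.swap ` ?V"
    by (force simp: triangular_grid_verts_def image_iff)
  then have "card ({0..int n} \<times> {0..int n}) \<le> card (?V \<union> prod.swap ` ?V)"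
    by (intro card_mono) (simp_all add: finite_triangular_grid_verts)
  also have "\<dots> \<le> card ?V + card (prod.swap ` ?V)"
    by (rule card_Un_le)
  also have "card (prod.swap ` ?V) = card ?V"
    by (simp add: card_image)
  finally show ?thesis
    by (simp add: card_cartesian_product power2_eq_square nat_add_distrib)
qed

lemma triangular_grid_apex:
  assumes "u \<in> triangular_grid_verts n"
  shows "\<exists>v w. (u, v) \<in> parcs (triangular_grid (Suc n)) \<and>
    (u, w) \<in> parcs (triangular_grid (Suc n)) \<and> (v, w) \<in> parcs (triangular_grid (Suc n))"
proof -
  obtain i j where "u = (i, j)" by fastforce
  then have "(u, (i + 1, j)) \<in> parcs (triangular_grid (Suc n)) \<and>
    (u, (i + 1, j + 1)) \<in> parcs (triangular_grid (Suc n)) \<and>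
    ((i + 1, j), (i + 1, j + 1)) \<in> parcs (triangular_grid (Suc n))"
    using assms by (simp add: triangular_grid_def triangular_grid_verts_def)
  then show ?thesis by blast
qed

lemma square_le_sum_index_cube:
  assumes "0 < n"
  shows "n\<^sup>2 \<le> 2 * sum_index (triangular_grid n) ^ 3"
proof -
  obtain m where n: "n = Suc m"
    using assms by (cases n) auto
  interpret pair_graph "triangular_grid n"
    by (rule pair_graph_triangular_grid)
  obtain f where f: "vertex_labeling (triangular_grid n) f"
      "num_edge_labels (triangular_grid n) f = sum_index (triangular_grid n)"
    using sum_index_attained(2)[OF pair_finite_verts pair_finite_arcs
        triangular_grid_has_edge[OF assms]] by blast
  have "triangular_grid_verts m \<subseteq> pverts (triangular_grid n)"
    by (auto simp: n triangular_grid_def triangular_grid_verts_def)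
  then have "card (triangular_grid_verts m) \<le> sum_index (triangular_grid n) ^ 3"
    unfolding f(2)[symmetric]
    by (rule card_triangle_vertices_le_cube[OF f(1) pair_finite_arcs])
      (unfold n, rule triangular_grid_apex)
  then show ?thesis
    using card_triangular_grid_verts_ge[of m] by (simp add: n)
qed

theorem corollary2p15:
  shows "\<exists>(c :: real) (n\<^sub>0 :: nat). c > 0 \<and>
    (\<forall>n :: nat. n \<ge> n\<^sub>0 \<longrightarrow> real (sum_index (triangular_grid n)) \<ge> c * real n powr (2 / 3))"
proof (intro exI conjI allI impI)
  fix n :: nat assume n: "1 \<le> n"
  let ?s = "real (sum_index (triangular_grid n))"
  have "real (n\<^sup>2) \<le> real (2 * sum_index (triangular_grid n) ^ 3)"
    using square_le_sum_index_cube[of n] n by (intro of_nat_mono) simp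
  then have bound: "(real n)\<^sup>2 \<le> 2 * ?s ^ 3"
    by simp
  have "(real n powr (2 / 3)) ^ 3 = (real n)\<^sup>2"
    using n by (simp add: powr_power)
  \<comment> \<open>Any constant with \<open>2 * c ^ 3 \<le> 1\<close> works; \<open>1 / 2\<close> is a convenient one.\<close>
  then have "(1 / 2 * real n powr (2 / 3)) ^ 3 = (real n)\<^sup>2 / 8"
    by (simp add: power_divide)
  also have "\<dots> \<le> ?s ^ 3"
    using bound zero_le_power2[of "real n"] by linarith
  finally show "1 / 2 * real n powr (2 / 3) \<le> ?s"
    by (rule power_le_imp_le_base[of _ 2, simplified]) simp
qed simp

end
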